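(* Let $(M,g,q)$ be a $3$-dimensional Riemannian manifold with circulant metric $g$ and circulant structure $q$ (as described in the context) whose curvature tensor satisfies $R(qx,qy,qz,qu)=R(x,y,z,u)$ for all $x,y,z,u$, and let a vector $x\in T_pM$ induce a $q$-basis of $T_pM$. Then $$\mu(x,qx)=\mu(qx,q^2x)=\mu(x,q^2x).$$
   Context: $(M,g,q)$ denotes a $3$-dimensional Riemannian manifold $M$ with local coordinates $(X^1,X^2,X^3)$ and coordinate basis $\{e_i\}$ of the tangent space $T_pM$, where the metric $g$ has the component matrix $$(g_{ij})=\begin{pmatrix} A & B & B \\ B & A & B \\ B & B & A \end{pmatrix},$$ with $A,B$ smooth functions of $X^1,X^2,X^3$ satisfying $A>B>0$, and $q$ is the endomorphism of the tangent spaces with coordinate matrix $$(q_i^{.j})=\begin{pmatrix}0&1&0\\0&0&1\\1&0&0\end{pmatrix},$$ so that $q^3=\mathrm{id}$ and $g(qx,qy)=g(x,y)$. With $\nabla$ the Levi-Civita connection of $g$, $R(x,y)z=\nabla_x\nabla_yz-\nabla_y\nabla_xz-\nabla_{[x,y]}z$ and $R(x,y,z,u)=g(R(x,y)z,u)$. A vector $x\in T_pM$ induces a $q$-basis if $\{x,qx,q^2x\}$ is a basis of $T_pM$. The sectional curvature of the non-degenerate $2$-plane spanned by $x,y\in T_pM$ is $$\mu(x,y)=\frac{R(x,y,x,y)}{g(x,x)g(y,y)-g^2(x,y)}.$$ *)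

theory Defs
  imports "HOL-Analysis.Analysis"
begin

section \<open>Smooth functions and 3-dimensional smooth manifolds\<close>

text \<open>On an open set of a Euclidean space, a map is of class C^(k+1) iff it is differentiable and
  all its directional derivatives are of class C^k.\<close>

primrec Ck_on :: "nat \<Rightarrow> 'a::euclidean_space set \<Rightarrow> ('a \<Rightarrow> 'b::real_normed_vector) \<Rightarrow> bool" where
  "Ck_on 0 U f \<longleftrightarrow> continuous_on U f"
| "Ck_on (Suc k) U f \<longleftrightarrow>
     f differentiable_on U \<and> (\<forall>v. Ck_on k U (\<lambda>x. frechet_derivative f (at x) v))"

definition smooth_on :: "'a::euclidean_space set \<Rightarrow> ('a \<Rightarrow> 'b::real_normed_vector) \<Rightarrow> bool" where
  "smooth_on U f \<longleftrightarrow> (\<forall>k. Ck_on k U f)"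

text \<open>A chart is a pair of its domain \<open>W\<close> and its coordinate map \<open>X = (X^1, X^2, X^3)\<close>; outside of
  \<open>W\<close> the values of \<open>X\<close> are irrelevant.\<close>

type_synonym 'm chart = "'m set \<times> ('m \<Rightarrow> real^3)"

definition is_chart :: "'m topology \<Rightarrow> 'm chart \<Rightarrow> bool" where
  "is_chart M = (\<lambda>(W, X). openin M W \<and> open (X ` W) \<and>
     homeomorphic_map (subtopology M W) (top_of_set (X ` W)) X)"

definition smooth_transition :: "'m chart \<Rightarrow> 'm chart \<Rightarrow> bool" where
  "smooth_transition = (\<lambda>(W, X) (W', X'). smooth_on (X ` (W \<inter> W')) (X' \<circ> inv_into W X))"

definition smooth_manifold :: "'m topology \<Rightarrow> 'm chart set \<Rightarrow> bool" where
  "smooth_manifold M atlas \<longleftrightarrow>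
     Hausdorff_space M \<and> second_countable M \<and>
     (\<forall>c\<in>atlas. is_chart M c) \<and> (\<Union>c\<in>atlas. fst c) = topspace M \<and>
     (\<forall>c\<in>atlas. \<forall>c'\<in>atlas. smooth_transition c c')"


section \<open>Calculus in local coordinates\<close>

text \<open>From here on everything lives on the domain \<open>W\<close> of one fixed chart \<open>(W, X)\<close>.  The tangent
  space at each \<open>p \<in> W\<close> is identified with \<open>real^3\<close> by means of the coordinate basis
  \<open>e\<^sub>1, e\<^sub>2, e\<^sub>3\<close> (with \<open>e\<^sub>i\<close> the partial derivative along \<open>X^i\<close>), so a vector field on \<open>W\<close>
  is the function \<open>'m \<Rightarrow> real^3\<close> of its components.\<close>

definition smooth_in_chart :: "'m set \<Rightarrow> ('m \<Rightarrow> real^3) \<Rightarrow> ('m \<Rightarrow> 'b::real_normed_vector) \<Rightarrow> bool" where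
  "smooth_in_chart W X f \<longleftrightarrow> smooth_on (X ` W) (f \<circ> inv_into W X)"

text \<open>The derivative \<open>V f\<close> of a function \<open>f\<close> along a vector field \<open>V\<close>, taken componentwise if \<open>f\<close> is
  vector valued.\<close>

definition deriv_along ::
    "'m set \<Rightarrow> ('m \<Rightarrow> real^3) \<Rightarrow> ('m \<Rightarrow> real^3) \<Rightarrow> ('m \<Rightarrow> 'b::real_normed_vector) \<Rightarrow> 'm \<Rightarrow> 'b" where
  "deriv_along W X V f p = frechet_derivative (f \<circ> inv_into W X) (at (X p)) (V p)"

text \<open>In components, \<open>[V, Y]^k = V^i \<partial>\<^sub>i Y^k - Y^i \<partial>\<^sub>i V^k\<close>.\<close>

definition lie_bracket ::
    "'m set \<Rightarrow> ('m \<Rightarrow> real^3) \<Rightarrow> ('m \<Rightarrow> real^3) \<Rightarrow> ('m \<Rightarrow> real^3) \<Rightarrow> 'm \<Rightarrow> real^3" where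
  "lie_bracket W X V Y p = deriv_along W X V Y p - deriv_along W X Y V p"

definition metric_form :: "real^3^3 \<Rightarrow> real^3 \<Rightarrow> real^3 \<Rightarrow> real" where
  "metric_form G x y = (\<Sum>i\<in>UNIV. \<Sum>j\<in>UNIV. G $ i $ j * x $ i * y $ j)"

text \<open>\<open>N V Y\<close> stands for the covariant derivative of \<open>Y\<close> along \<open>V\<close>; \<open>G\<close> is the matrix function of the
  metric in the chart.  All requirements concern smooth fields and points of \<open>W\<close> only.\<close>

definition affine_connection ::
    "'m set \<Rightarrow> ('m \<Rightarrow> real^3) \<Rightarrow> (('m \<Rightarrow> real^3) \<Rightarrow> ('m \<Rightarrow> real^3) \<Rightarrow> 'm \<Rightarrow> real^3) \<Rightarrow> bool" where
  "affine_connection W X N \<longleftrightarrow>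
     (\<forall>V Y. smooth_in_chart W X V \<longrightarrow> smooth_in_chart W X Y \<longrightarrow> smooth_in_chart W X (N V Y)) \<and>
     (\<forall>V V' Y. smooth_in_chart W X V \<longrightarrow> smooth_in_chart W X V' \<longrightarrow> smooth_in_chart W X Y \<longrightarrow>
        (\<forall>p\<in>W. N (\<lambda>r. V r + V' r) Y p = N V Y p + N V' Y p)) \<and>
     (\<forall>f V Y. smooth_in_chart W X f \<longrightarrow> smooth_in_chart W X V \<longrightarrow> smooth_in_chart W X Y \<longrightarrow>
        (\<forall>p\<in>W. N (\<lambda>r. f r *\<^sub>R V r) Y p = f p *\<^sub>R N V Y p)) \<and>
     (\<forall>V Y Y'. smooth_in_chart W X V \<longrightarrow> smooth_in_chart W X Y \<longrightarrow> smooth_in_chart W X Y' \<longrightarrow>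
        (\<forall>p\<in>W. N V (\<lambda>r. Y r + Y' r) p = N V Y p + N V Y' p)) \<and>
     (\<forall>f V Y. smooth_in_chart W X f \<longrightarrow> smooth_in_chart W X V \<longrightarrow> smooth_in_chart W X Y \<longrightarrow>
        (\<forall>p\<in>W. N V (\<lambda>r. f r *\<^sub>R Y r) p = deriv_along W X V f p *\<^sub>R Y p + f p *\<^sub>R N V Y p))"

definition levi_civita ::
    "'m set \<Rightarrow> ('m \<Rightarrow> real^3) \<Rightarrow> ('m \<Rightarrow> real^3^3) \<Rightarrow>
     (('m \<Rightarrow> real^3) \<Rightarrow> ('m \<Rightarrow> real^3) \<Rightarrow> 'm \<Rightarrow> real^3) \<Rightarrow> bool" where
  "levi_civita W X G N \<longleftrightarrow> affine_connection W X N \<and>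
     (\<forall>V Y. smooth_in_chart W X V \<longrightarrow> smooth_in_chart W X Y \<longrightarrow>
        (\<forall>p\<in>W. N V Y p - N Y V p = lie_bracket W X V Y p)) \<and>
     (\<forall>V Y Z. smooth_in_chart W X V \<longrightarrow> smooth_in_chart W X Y \<longrightarrow> smooth_in_chart W X Z \<longrightarrow>
        (\<forall>p\<in>W. deriv_along W X V (\<lambda>r. metric_form (G r) (Y r) (Z r)) p =
           metric_form (G p) (N V Y p) (Z p) + metric_form (G p) (Y p) (N V Z p)))"

definition curvature ::
    "'m set \<Rightarrow> ('m \<Rightarrow> real^3) \<Rightarrow> (('m \<Rightarrow> real^3) \<Rightarrow> ('m \<Rightarrow> real^3) \<Rightarrow> 'm \<Rightarrow> real^3) \<Rightarrow>
     ('m \<Rightarrow> real^3) \<Rightarrow> ('m \<Rightarrow> real^3) \<Rightarrow> ('m \<Rightarrow> real^3) \<Rightarrow> 'm \<Rightarrow> real^3" where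
  "curvature W X N V Y Z p = N V (N Y Z) p - N Y (N V Z) p - N (lie_bracket W X V Y) Z p"

text \<open>The curvature is a tensor: its value at \<open>p\<close> depends only on the values of the fields at \<open>p\<close>.
  Hence it may be evaluated on tangent vectors by extending them to fields, here those with
  constant components.\<close>

definition riemann ::
    "'m set \<Rightarrow> ('m \<Rightarrow> real^3) \<Rightarrow> ('m \<Rightarrow> real^3^3) \<Rightarrow>
     (('m \<Rightarrow> real^3) \<Rightarrow> ('m \<Rightarrow> real^3) \<Rightarrow> 'm \<Rightarrow> real^3) \<Rightarrow>
     'm \<Rightarrow> real^3 \<Rightarrow> real^3 \<Rightarrow> real^3 \<Rightarrow> real^3 \<Rightarrow> real" where
  "riemann W X G N p x y z u =
     metric_form (G p) (curvature W X N (\<lambda>_. x) (\<lambda>_. y) (\<lambda>_. z) p) u"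

text \<open>The order of the arguments in \<open>R(x,y,x,y)\<close>, combined with \<open>R(x,y,z,u) = g(R(x,y)z,u)\<close>, is the
  source's; it makes \<open>\<mu>\<close> the negative of the sectional curvature in the more common convention.\<close>

definition sectional ::
    "'m set \<Rightarrow> ('m \<Rightarrow> real^3) \<Rightarrow> ('m \<Rightarrow> real^3^3) \<Rightarrow>
     (('m \<Rightarrow> real^3) \<Rightarrow> ('m \<Rightarrow> real^3) \<Rightarrow> 'm \<Rightarrow> real^3) \<Rightarrow>
     'm \<Rightarrow> real^3 \<Rightarrow> real^3 \<Rightarrow> real" where
  "sectional W X G N p x y =
     riemann W X G N p x y x y /
     (metric_form (G p) x x * metric_form (G p) y y - (metric_form (G p) x y)\<^sup>2)"


section \<open>The circulant metric and the circulant structure\<close>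

definition circ_metric :: "real \<Rightarrow> real \<Rightarrow> real^3^3" where
  "circ_metric a b = vector [vector [a, b, b], vector [b, a, b], vector [b, b, a]]"

definition circ_matrix :: "real^3^3" where
  "circ_matrix = vector [vector [0, 1, 0], vector [0, 0, 1], vector [1, 0, 0]]"

text \<open>The lower index of \<open>q\<^sub>i\<^sup>j\<close> is the row index: \<open>(q x)^j = x^i q\<^sub>i\<^sup>j\<close>, so that
  \<open>q e\<^sub>1 = e\<^sub>2\<close>, \<open>q e\<^sub>2 = e\<^sub>3\<close>, \<open>q e\<^sub>3 = e\<^sub>1\<close>.\<close>

definition circ_q :: "real^3 \<Rightarrow> real^3" where
  "circ_q x = x v* circ_matrix"

definition induces_q_basis :: "real^3 \<Rightarrow> bool" where
  "induces_q_basis x \<longleftrightarrow>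
     independent {x, circ_q x, circ_q (circ_q x)} \<and> span {x, circ_q x, circ_q (circ_q x)} = UNIV"

end

theory Submission
  imports Defs
begin

text \<open>
  Invariance under \<open>q\<close> gives \<open>\<mu>(x, qx) = \<mu>(qx, q\<^sup>2x) = \<mu>(q\<^sup>2x, x)\<close> because \<open>q\<close> is an isometry with
  \<open>q\<^sup>3 = id\<close>, and \<open>\<mu>\<close> is symmetric because \<open>R\<close> is skew in its first two and in its last two arguments.
  Skewness in the last two comes from differentiating \<open>g(z, u)\<close> twice by metric compatibility, where
  the second derivatives along \<open>x\<close> and \<open>y\<close> commute.
\<close>

section \<open>Symmetry of second derivatives\<close>

text \<open>The mean value theorem in the direction \<open>x\<close> turns the second difference of
  \<open>f\<close> into \<open>t\<close> times a difference of two values of the first derivative.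
  Differentiability of that derivative at \<open>p\<close> evaluates this as \<open>t * L y\<close>
  up to \<open>e * t\<close>.\<close>

lemma second_difference_estimate:
  fixes f :: "'a::real_normed_vector \<Rightarrow> real"
  assumes "open S" "p \<in> S"
    and f: "\<And>z. z \<in> S \<Longrightarrow> f differentiable (at z)"
    and L: "((\<lambda>z. frechet_derivative f (at z) x) has_derivative L) (at p)"
    and "e > 0"
  shows "\<exists>d>0. \<forall>t. 0 < t \<longrightarrow> t < d \<longrightarrow>
    \<bar>f (p + t *\<^sub>R x + t *\<^sub>R y) - f (p + t *\<^sub>R x) - f (p + t *\<^sub>R y) + f p - t\<^sup>2 * L y\<bar> \<le> e * t\<^sup>2"
proof -
  define G where "G z = frechet_derivative f (at z) x" for z
  \<comment> \<open>With this \<open>K\<close>, all points of the parallelogram with edges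
    \<open>t *\<^sub>R x\<close> and \<open>t *\<^sub>R y\<close> at \<open>p\<close> lie within
    \<open>t * K\<close> of \<open>p\<close>. The summand 1 keeps \<open>K\<close> positive when
    both vectors vanish.\<close>
  define K where "K = norm x + norm y + 1"
  have K: "K > 0" by (simp add: K_def add_nonneg_pos)
  interpret L: bounded_linear L using L by (rule has_derivative_bounded_linear)
  obtain d1 where d1: "d1 > 0" "ball p d1 \<subseteq> S"
    using assms(1,2) openE by blast
  \<comment> \<open>The error of the linear approximation enters at two points, each at distance at
    most \<open>t * K\<close>, so each contributes at most \<open>e / 2 * t\<close>.\<close>
  have "e / (2 * K) > 0" using K \<open>e > 0\<close> by simp
  then obtain d2 where d2: "d2 > 0"
    "\<And>z. norm (z - p) < d2 \<Longrightarrow> norm (G z - G p - L (z - p)) \<le> e / (2 * K) * norm (z - p)"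
    using L unfolding has_derivative_at_alt G_def by blast
  have "\<bar>f (p + t *\<^sub>R x + t *\<^sub>R y) - f (p + t *\<^sub>R x) - f (p + t *\<^sub>R y) + f p - t\<^sup>2 * L y\<bar> \<le> e * t\<^sup>2"
    if t: "0 < t" "t < min d1 d2 / K" for t
  proof -
    have tK: "t * K < d1" "t * K < d2" using t K by (auto simp: field_simps)
    have near: "norm (s *\<^sub>R x + c *\<^sub>R y) \<le> t * K" if "0 \<le> s" "s \<le> t" "0 \<le> c" "c \<le> t" for s c
    proof -
      have "norm (s *\<^sub>R x + c *\<^sub>R y) \<le> s * norm x + c * norm y"
        using norm_triangle_ineq[of "s *\<^sub>R x" "c *\<^sub>R y"] that by simp
      also have "\<dots> \<le> t * norm x + t * norm y"
        using that by (intro add_mono mult_right_mono) auto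
      also have "\<dots> \<le> t * K" using t by (simp add: K_def algebra_simps)
      finally show ?thesis .
    qed
    have inS: "p + (s *\<^sub>R x + c *\<^sub>R y) \<in> S" if "0 \<le> s" "s \<le> t" "0 \<le> c" "c \<le> t" for s c
    proof -
      have "dist p (p + v) = norm v" for v by (simp add: dist_norm)
      then show ?thesis using near[OF that] tK by (intro subsetD[OF d1(2)]) simp
    qed
    \<comment> \<open>The second difference is \<open>h t - h 0\<close>. The term
      \<open>0 *\<^sub>R y\<close> is kept so that \<open>fd\<close> and \<open>est\<close> cover
      both edges parallel to \<open>x\<close>, with \<open>c = t\<close> and
      \<open>c = 0\<close>.\<close>
    define h where "h s = f (p + (s *\<^sub>R x + t *\<^sub>R y)) - f (p + (s *\<^sub>R x + 0 *\<^sub>R y))" for s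
    have fd: "((\<lambda>s. f (p + (s *\<^sub>R x + c *\<^sub>R y))) has_derivative
        (\<lambda>k. k * G (p + (s *\<^sub>R x + c *\<^sub>R y)))) (at s within {0..t})"
      if "0 \<le> s" "s \<le> t" "0 \<le> c" "c \<le> t" for s c
    proof -
      let ?z = "p + (s *\<^sub>R x + c *\<^sub>R y)"
      have D: "(f has_derivative frechet_derivative f (at ?z)) (at ?z)"
        using f[OF inS[OF that]] frechet_derivative_works by blast
      have "((\<lambda>s. p + (s *\<^sub>R x + c *\<^sub>R y)) has_derivative (\<lambda>k. k *\<^sub>R x)) (at s within {0..t})"
        by (auto intro!: derivative_eq_intros)
      from has_derivative_compose[OF this D] show ?thesis
        using linear_cmul[OF linear_frechet_derivative[OF f[OF inS[OF that]]]]
        by (simp add: G_def)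
    qed
    have "\<exists>s\<in>{0<..<t}. h t - h 0 =
      (\<lambda>k. k * G (p + (s *\<^sub>R x + t *\<^sub>R y)) - k * G (p + (s *\<^sub>R x + 0 *\<^sub>R y))) (t - 0)"
      unfolding h_def using t by (intro mvt_simple has_derivative_diff fd) auto
    then obtain s where s: "0 < s" "s < t"
      and hs: "h t - h 0 = t * (G (p + (s *\<^sub>R x + t *\<^sub>R y)) - G (p + (s *\<^sub>R x + 0 *\<^sub>R y)))"
      by (auto simp: algebra_simps)
    have est: "\<bar>G (p + (s *\<^sub>R x + c *\<^sub>R y)) - G p - L (s *\<^sub>R x + c *\<^sub>R y)\<bar> \<le> e / 2 * t"
      if "0 \<le> c" "c \<le> t" for c
    proof -
      have n: "norm (s *\<^sub>R x + c *\<^sub>R y) \<le> t * K" using near that s by simp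
      have "\<bar>G (p + (s *\<^sub>R x + c *\<^sub>R y)) - G p - L (s *\<^sub>R x + c *\<^sub>R y)\<bar>
          \<le> e / (2 * K) * norm (s *\<^sub>R x + c *\<^sub>R y)"
        using d2(2)[of "p + (s *\<^sub>R x + c *\<^sub>R y)"] n tK by simp
      also have "\<dots> \<le> e / (2 * K) * (t * K)"
        using n K \<open>e > 0\<close> by (intro mult_left_mono) auto
      also have "\<dots> = e / 2 * t" using K by simp
      finally show ?thesis .
    qed
    let ?D = "G (p + (s *\<^sub>R x + t *\<^sub>R y)) - G (p + (s *\<^sub>R x + 0 *\<^sub>R y))"
    let ?r = "\<lambda>c. G (p + (s *\<^sub>R x + c *\<^sub>R y)) - G p - L (s *\<^sub>R x + c *\<^sub>R y)"
    \<comment> \<open>By linearity \<open>L\<close> takes values differing by \<open>t * L y\<close>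
      at the two points, so the unknown intermediate value \<open>s\<close> cancels.\<close>
    have "?D - t * L y = ?r t - ?r 0" by (simp add: L.add L.scaleR)
    also have "\<bar>\<dots>\<bar> \<le> \<bar>?r t\<bar> + \<bar>?r 0\<bar>" by (rule abs_triangle_ineq4)
    also have "\<dots> \<le> e / 2 * t + e / 2 * t" using t by (intro add_mono est) auto
    also have "\<dots> = e * t" by simp
    finally have "\<bar>?D - t * L y\<bar> \<le> e * t" .
    then have "t * \<bar>?D - t * L y\<bar> \<le> t * (e * t)"
      using t by (intro mult_left_mono) auto
    moreover have "t * \<bar>?D - t * L y\<bar> = \<bar>t * ?D - t\<^sup>2 * L y\<bar>"
      using t by (simp add: abs_mult_pos' algebra_simps power2_eq_square)
    ultimately have "\<bar>h t - h 0 - t\<^sup>2 * L y\<bar> \<le> e * t\<^sup>2"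
      unfolding hs by (simp add: power2_eq_square mult.commute mult.left_commute)
    then show ?thesis by (simp add: h_def add.assoc)
  qed
  then show ?thesis
    using d1(1) d2(1) K by (intro exI[of _ "min d1 d2 / K"]) auto
qed

text \<open>The second difference is symmetric in \<open>x\<close> and \<open>y\<close>, and divided
  by \<open>t\<^sup>2\<close> it approximates either mixed derivative to any accuracy.\<close>

theorem frechet_derivative_commute:
  fixes f :: "'a::real_normed_vector \<Rightarrow> real"
  assumes S: "open S" "p \<in> S"
    and f: "\<And>z. z \<in> S \<Longrightarrow> f differentiable (at z)"
    and dx: "(\<lambda>z. frechet_derivative f (at z) x) differentiable (at p)"
    and dy: "(\<lambda>z. frechet_derivative f (at z) y) differentiable (at p)"
  shows "frechet_derivative (\<lambda>z. frechet_derivative f (at z) x) (at p) y =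
    frechet_derivative (\<lambda>z. frechet_derivative f (at z) y) (at p) x" (is "?a = ?b")
proof -
  have close: "\<bar>?a - ?b\<bar> \<le> e" if "e > 0" for e
  proof -
    from that have e: "e / 2 > 0" by simp
    obtain d where d: "d > 0" "\<And>t. 0 < t \<Longrightarrow> t < d \<Longrightarrow>
        \<bar>f (p + t *\<^sub>R x + t *\<^sub>R y) - f (p + t *\<^sub>R x) - f (p + t *\<^sub>R y) + f p - t\<^sup>2 * ?a\<bar> \<le> e / 2 * t\<^sup>2"
      using second_difference_estimate[OF S f dx[unfolded frechet_derivative_works] e, where y=y] by blast
    obtain d' where d': "d' > 0" "\<And>t. 0 < t \<Longrightarrow> t < d' \<Longrightarrow>
        \<bar>f (p + t *\<^sub>R y + t *\<^sub>R x) - f (p + t *\<^sub>R y) - f (p + t *\<^sub>R x) + f p - t\<^sup>2 * ?b\<bar> \<le> e / 2 * t\<^sup>2"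
      using second_difference_estimate[OF S f dy[unfolded frechet_derivative_works] e, where y=x] by blast
    obtain t where t: "0 < t" "t < d" "t < d'"
      using field_lbound_gt_zero[OF d(1) d'(1)] by blast
    have comm: "p + t *\<^sub>R y + t *\<^sub>R x = p + t *\<^sub>R x + t *\<^sub>R y" by simp
    have "\<bar>t\<^sup>2 * ?a - t\<^sup>2 * ?b\<bar> \<le> e / 2 * t\<^sup>2 + e / 2 * t\<^sup>2"
      using d(2)[OF t(1,2)] d'(2)[OF t(1,3)] unfolding comm by linarith
    moreover have "\<bar>t\<^sup>2 * ?a - t\<^sup>2 * ?b\<bar> = t\<^sup>2 * \<bar>?a - ?b\<bar>"
      by (simp add: abs_mult flip: right_diff_distrib)
    ultimately have "t\<^sup>2 * \<bar>?a - ?b\<bar> \<le> t\<^sup>2 * e" by (simp add: algebra_simps)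
    then show ?thesis using t by simp
  qed
  have "\<bar>?a - ?b\<bar> \<le> 0" by (rule dense_ge) (rule close)
  then show ?thesis by simp
qed

section \<open>Fields in a chart and algebra of the metric form\<close>

lemma smooth_in_chart_const: "smooth_in_chart W X (\<lambda>_. c)"
proof -
  \<comment> \<open>The derivative of a constant is the constant 0, so the induction has to run over
    all constants at once.\<close>
  have "Ck_on k U (\<lambda>_. c)" for k and U :: "(real^3) set" and c :: 'b
    by (induction k arbitrary: c) auto
  then show ?thesis by (simp add: smooth_in_chart_def smooth_on_def o_def)
qed

lemma smooth_in_chart_differentiable:
  assumes "smooth_in_chart W X f" "open (X ` W)" "p \<in> W"
  shows "(f \<circ> inv_into W X) differentiable (at (X p))"
proof -
  have "Ck_on (Suc 0) (X ` W) (f \<circ> inv_into W X)"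
    using assms(1) unfolding smooth_in_chart_def smooth_on_def by blast
  then show ?thesis
    using assms(2,3) by (auto simp: differentiable_on_eq_differentiable_at)
qed

lemma is_chart_open: "is_chart M (W, X) \<Longrightarrow> open (X ` W)"
  by (simp add: is_chart_def)

lemma is_chart_inj_on: "is_chart M (W, X) \<Longrightarrow> inj_on X W"
  unfolding is_chart_def
  by (auto dest!: homeomorphic_imp_injective_map openin_subset simp: Int_absorb1)

lemma deriv_along_const [simp]: "deriv_along W X V (\<lambda>_. c) p = 0"
  by (simp add: deriv_along_def o_def)

text \<open>Coordinate fields commute, which removes the bracket term when curvature is evaluated on
  constant extensions of tangent vectors.\<close>

lemma lie_bracket_const [simp]: "lie_bracket W X (\<lambda>_. x) (\<lambda>_. y) = (\<lambda>_. 0)"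
  by (simp add: lie_bracket_def fun_eq_iff)

lemma differentiable_vec_nth:
  "f differentiable F \<Longrightarrow> (\<lambda>z. f z $ i) differentiable F"
  unfolding differentiable_def
  using bounded_linear.has_derivative[OF bounded_linear_vec_nth] by blast

lemma metric_form_commute:
  assumes "\<And>i j. G $ i $ j = G $ j $ i"
  shows "metric_form G x y = metric_form G y x"
proof -
  have "metric_form G x y = (\<Sum>j\<in>UNIV. \<Sum>i\<in>UNIV. G $ i $ j * x $ i * y $ j)"
    unfolding metric_form_def by (rule sum.swap)
  also have "\<dots> = metric_form G y x"
    unfolding metric_form_def using assms by (intro sum.cong refl) (metis mult.assoc mult.commute)
  finally show ?thesis .
qed

lemma metric_form_diff_left: "metric_form G (x - x') y = metric_form G x y - metric_form G x' y"
  by (simp add: metric_form_def algebra_simps sum_subtractf)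

lemma metric_form_diff_right: "metric_form G x (y - y') = metric_form G x y - metric_form G x y'"
  by (simp add: metric_form_def algebra_simps sum_subtractf)

lemma metric_form_minus_left: "metric_form G (- x) y = - metric_form G x y"
  by (simp add: metric_form_def sum_negf)

section \<open>Skew symmetries of the Levi-Civita curvature\<close>

text \<open>The skew symmetries are proved for a general symmetric matrix \<open>g\<close> with
  differentiable entries; the circulant metric is an instance. Injectivity lets
  \<open>inv_into W X\<close> recover each point of \<open>W\<close> from its coordinates.\<close>

locale levi_civita_chart =
  fixes W :: "'m set" and X :: "'m \<Rightarrow> real^3" and g :: "'m \<Rightarrow> real^3^3"
    and nabla :: "('m \<Rightarrow> real^3) \<Rightarrow> ('m \<Rightarrow> real^3) \<Rightarrow> 'm \<Rightarrow> real^3"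
  assumes open_image: "open (X ` W)"
    and inj: "inj_on X W"
    and metric_differentiable:
      "\<And>p i j. p \<in> W \<Longrightarrow> (\<lambda>z. g (inv_into W X z) $ i $ j) differentiable (at (X p))"
    and metric_sym: "\<And>p i j. p \<in> W \<Longrightarrow> g p $ i $ j = g p $ j $ i"
    and nabla: "levi_civita W X g nabla"
begin

lemma smooth_nabla:
  "smooth_in_chart W X V \<Longrightarrow> smooth_in_chart W X Y \<Longrightarrow> smooth_in_chart W X (nabla V Y)"
  using nabla by (simp add: levi_civita_def affine_connection_def)

text \<open>Linearity over functions in the direction argument, with factor 0. It disposes of the
  derivative along the vanishing bracket in \<open>curvature\<close>.\<close>

lemma nabla_zero:
  assumes "smooth_in_chart W X Y" "p \<in> W"
  shows "nabla (\<lambda>_. 0) Y p = 0"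
proof -
  have "\<forall>f V Y. smooth_in_chart W X f \<longrightarrow> smooth_in_chart W X V \<longrightarrow> smooth_in_chart W X Y \<longrightarrow>
        (\<forall>p\<in>W. nabla (\<lambda>r. f r *\<^sub>R V r) Y p = f p *\<^sub>R nabla V Y p)"
    using nabla by (simp add: levi_civita_def affine_connection_def)
  from this[rule_format, OF smooth_in_chart_const smooth_in_chart_const assms, of 0 0]
  show ?thesis by simp
qed

lemma compatible:
  "smooth_in_chart W X V \<Longrightarrow> smooth_in_chart W X Y \<Longrightarrow> smooth_in_chart W X Z \<Longrightarrow> p \<in> W \<Longrightarrow>
    deriv_along W X V (\<lambda>r. metric_form (g r) (Y r) (Z r)) p =
      metric_form (g p) (nabla V Y p) (Z p) + metric_form (g p) (Y p) (nabla V Z p)"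
  using nabla unfolding levi_civita_def by blast

lemma differentiable_metric_form:
  assumes "smooth_in_chart W X Y" "smooth_in_chart W X Z" "p \<in> W"
  shows "((\<lambda>r. metric_form (g r) (Y r) (Z r)) \<circ> inv_into W X) differentiable (at (X p))"
  using assms smooth_in_chart_differentiable[OF _ open_image] unfolding metric_form_def o_def
  by (intro differentiable_sum ballI differentiable_mult differentiable_vec_nth
      metric_differentiable) auto

lemma curvature_const_swap:
  assumes "p \<in> W"
  shows "curvature W X nabla (\<lambda>_. x) (\<lambda>_. y) (\<lambda>_. z) p =
    - curvature W X nabla (\<lambda>_. y) (\<lambda>_. x) (\<lambda>_. z) p"
  by (simp add: curvature_def nabla_zero[OF smooth_in_chart_const assms])

lemma riemann_skew_left:
  "p \<in> W \<Longrightarrow> riemann W X g nabla p x y z u = - riemann W X g nabla p y x z u"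
  unfolding riemann_def by (subst curvature_const_swap) (simp_all add: metric_form_minus_left)

text \<open>Metric compatibility is applied along \<open>y\<close> and then to each resulting term
  along \<open>x\<close>. The two middle products are exchanged when \<open>x\<close> and
  \<open>y\<close> are, so they will cancel in the difference of the two orders.\<close>

lemma deriv_along_twice_metric_form:
  assumes p: "p \<in> W"
  shows "frechet_derivative (\<lambda>w. frechet_derivative
      ((\<lambda>r. metric_form (g r) z u) \<circ> inv_into W X) (at w) y) (at (X p)) x =
    metric_form (g p) (nabla (\<lambda>_. x) (nabla (\<lambda>_. y) (\<lambda>_. z)) p) u +
    metric_form (g p) (nabla (\<lambda>_. y) (\<lambda>_. z) p) (nabla (\<lambda>_. x) (\<lambda>_. u) p) +
    (metric_form (g p) (nabla (\<lambda>_. x) (\<lambda>_. z) p) (nabla (\<lambda>_. y) (\<lambda>_. u) p) +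
     metric_form (g p) z (nabla (\<lambda>_. x) (nabla (\<lambda>_. y) (\<lambda>_. u)) p))"
    (is "frechet_derivative ?D _ _ = _")
    and "(\<lambda>w. frechet_derivative
      ((\<lambda>r. metric_form (g r) z u) \<circ> inv_into W X) (at w) y) differentiable (at (X p))"
proof -
  note c = smooth_in_chart_const
  let ?I = "inv_into W X"
  let ?F = "(\<lambda>r. metric_form (g r) (nabla (\<lambda>_. y) (\<lambda>_. z) r) u) \<circ> ?I"
  let ?H = "(\<lambda>r. metric_form (g r) z (nabla (\<lambda>_. y) (\<lambda>_. u) r)) \<circ> ?I"
  \<comment> \<open>Compatibility is only available at points of \<open>W\<close>, so the first
    derivative is known on the image of the chart alone.\<close>
  have D: "?D w = ?F w + ?H w" if "w \<in> X ` W" for w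
  proof -
    obtain r where r: "r \<in> W" "w = X r" using \<open>w \<in> X ` W\<close> by blast
    show ?thesis
      using compatible[OF c c c r(1), of y z u] r inj by (simp add: deriv_along_def)
  qed
  have F: "?F differentiable (at (X p))" and H: "?H differentiable (at (X p))"
    using differentiable_metric_form[OF _ _ p] smooth_nabla c by blast+
  have FH: "((\<lambda>w. ?F w + ?H w) has_derivative
      (\<lambda>h. frechet_derivative ?F (at (X p)) h + frechet_derivative ?H (at (X p)) h)) (at (X p))"
    using F H frechet_derivative_works by (intro has_derivative_add) blast+
  have Xp: "X p \<in> X ` W" using p by blast
  have DFH: "(?D has_derivative
      (\<lambda>h. frechet_derivative ?F (at (X p)) h + frechet_derivative ?H (at (X p)) h)) (at (X p))"
    by (rule has_derivative_transform_within_open[OF FH open_image Xp]) (rule D[symmetric])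
  then show "?D differentiable (at (X p))" by (auto simp: differentiable_def)
  have "frechet_derivative ?D (at (X p)) x =
      frechet_derivative ?F (at (X p)) x + frechet_derivative ?H (at (X p)) x"
    by (rule fun_cong[OF frechet_derivative_at[OF DFH, symmetric]])
  then show "frechet_derivative ?D (at (X p)) x =
    metric_form (g p) (nabla (\<lambda>_. x) (nabla (\<lambda>_. y) (\<lambda>_. z)) p) u +
    metric_form (g p) (nabla (\<lambda>_. y) (\<lambda>_. z) p) (nabla (\<lambda>_. x) (\<lambda>_. u) p) +
    (metric_form (g p) (nabla (\<lambda>_. x) (\<lambda>_. z) p) (nabla (\<lambda>_. y) (\<lambda>_. u) p) +
     metric_form (g p) z (nabla (\<lambda>_. x) (nabla (\<lambda>_. y) (\<lambda>_. u)) p))"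
    using compatible[OF c smooth_nabla[OF c c] c p, of x y z u]
      compatible[OF c c smooth_nabla[OF c c] p, of x z y u]
    by (simp add: deriv_along_def)
qed

text \<open>Both orders of differentiating g(z, u) agree. Their difference is g(R(x,y)z, u) + g(z,
  R(x,y)u), which is therefore 0; symmetry of g then gives the claim.\<close>

lemma riemann_skew_right:
  assumes p: "p \<in> W"
  shows "riemann W X g nabla p x y z u = - riemann W X g nabla p x y u z"
proof -
  note c = smooth_in_chart_const
  let ?f = "(\<lambda>r. metric_form (g r) z u) \<circ> inv_into W X"
  have "X p \<in> X ` W" using p by blast
  moreover have "?f differentiable (at w)" if "w \<in> X ` W" for w
    using that differentiable_metric_form[OF c c] by blast
  ultimately have "frechet_derivative (\<lambda>w. frechet_derivative ?f (at w) y) (at (X p)) x =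
      frechet_derivative (\<lambda>w. frechet_derivative ?f (at w) x) (at (X p)) y"
    using deriv_along_twice_metric_form(2)[OF p]
    by (intro frechet_derivative_commute[OF open_image])
  then have "metric_form (g p) (curvature W X nabla (\<lambda>_. x) (\<lambda>_. y) (\<lambda>_. z) p) u +
      metric_form (g p) z (curvature W X nabla (\<lambda>_. x) (\<lambda>_. y) (\<lambda>_. u) p) = 0"
    unfolding deriv_along_twice_metric_form(1)[OF p]
    by (simp add: curvature_def nabla_zero[OF c p] metric_form_diff_left metric_form_diff_right)
  then show ?thesis
    using metric_form_commute[OF metric_sym[OF p], of z] by (simp add: riemann_def)
qed

lemma sectional_commute:
  assumes p: "p \<in> W"
  shows "sectional W X g nabla p x y = sectional W X g nabla p y x"
proof -
  have "riemann W X g nabla p x y x y = riemann W X g nabla p y x y x"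
    using riemann_skew_left[OF p, of x y x y] riemann_skew_right[OF p, of y x x y] by simp
  then show ?thesis
    using metric_form_commute[OF metric_sym[OF p], of x y]
    by (simp add: sectional_def mult.commute)
qed

end

section \<open>The circulant metric and the equality of the curvatures\<close>

lemma circ_q_components: "circ_q x $ 1 = x $ 3" "circ_q x $ 2 = x $ 1" "circ_q x $ 3 = x $ 2"
  by (simp_all add: circ_q_def circ_matrix_def vector_matrix_mult_def sum_3)

lemma circ_q_cubed: "circ_q (circ_q (circ_q x)) = x"
  by (simp add: vec_eq_iff forall_3 circ_q_components)

lemma circ_metric_components: "circ_metric a b $ i $ j = (if i = j then a else b)"
  using exhaust_3[of i] exhaust_3[of j] by (auto simp: circ_metric_def)

text \<open>The structure permutes the coordinates cyclically, and an entry of the metric depends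
  only on whether its two indices coincide.\<close>

lemma metric_form_circ_q:
  "metric_form (circ_metric a b) (circ_q x) (circ_q y) = metric_form (circ_metric a b) x y"
  by (simp add: metric_form_def sum_3 circ_metric_components circ_q_components)

theorem proposition4p1:
  fixes M :: "'m topology" and atlas :: "'m chart set"
    and W :: "'m set" and X :: "'m \<Rightarrow> real^3"
    and A B :: "'m \<Rightarrow> real" and g :: "'m \<Rightarrow> real^3^3"
    and nabla :: "('m \<Rightarrow> real^3) \<Rightarrow> ('m \<Rightarrow> real^3) \<Rightarrow> 'm \<Rightarrow> real^3"
    and p :: 'm and x :: "real^3"
  assumes manifold: "smooth_manifold M atlas" "(W, X) \<in> atlas"
    and smooth: "smooth_in_chart W X A" "smooth_in_chart W X B"
    and AB: "\<And>r. r \<in> W \<Longrightarrow> A r > B r \<and> B r > 0"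
    and metric: "\<And>r. r \<in> W \<Longrightarrow> g r = circ_metric (A r) (B r)"
    and nabla: "levi_civita W X g nabla"
    and invariant: "\<And>r y1 y2 y3 y4. r \<in> W \<Longrightarrow>
      riemann W X g nabla r (circ_q y1) (circ_q y2) (circ_q y3) (circ_q y4) =
      riemann W X g nabla r y1 y2 y3 y4"
    and p: "p \<in> W"
    and x: "induces_q_basis x"
  shows "sectional W X g nabla p x (circ_q x) =
           sectional W X g nabla p (circ_q x) (circ_q (circ_q x)) \<and>
         sectional W X g nabla p (circ_q x) (circ_q (circ_q x)) =
           sectional W X g nabla p x (circ_q (circ_q x))"
proof -
  have chart: "is_chart M (W, X)"
    using manifold by (auto simp: smooth_manifold_def)
  interpret levi_civita_chart W X g nabla
  proof
    show "open (X ` W)" "inj_on X W"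
      using chart by (rule is_chart_open is_chart_inj_on)+
    show "levi_civita W X g nabla" by (rule nabla)
    show "g r $ i $ j = g r $ j $ i" if "r \<in> W" for r i j
      using metric[OF that] by (simp add: circ_metric_components)
    show "(\<lambda>z. g (inv_into W X z) $ i $ j) differentiable (at (X r))" if r: "r \<in> W" for r i j
    proof -
      \<comment> \<open>The entries of \<open>g\<close> are \<open>A\<close> or \<open>B\<close>
        only over \<open>W\<close>, so differentiability is again carried over on the open image of
        the chart.\<close>
      let ?f = "(if i = j then A else B) \<circ> inv_into W X"
      have "?f differentiable (at (X r))"
        using smooth smooth_in_chart_differentiable[OF _ is_chart_open[OF chart] r] by auto
      then obtain f' where "(?f has_derivative f') (at (X r))"
        by (auto simp: differentiable_def)
      then have "((\<lambda>z. g (inv_into W X z) $ i $ j) has_derivative f') (at (X r))"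
      proof (rule has_derivative_transform_within_open[OF _ is_chart_open[OF chart]])
        show "X r \<in> X ` W" using r by blast
        show "?f z = g (inv_into W X z) $ i $ j" if "z \<in> X ` W" for z
          using metric[OF inv_into_into[OF that]] by (simp add: circ_metric_components)
      qed
      then show ?thesis by (auto simp: differentiable_def)
    qed
  qed
  \<comment> \<open>The numerator is preserved by the assumed invariance of the curvature, the
    denominator because \<open>circ_q\<close> is an isometry.\<close>
  have q: "sectional W X g nabla p (circ_q y) (circ_q z) = sectional W X g nabla p y z" for y z
    by (simp add: sectional_def invariant[OF p] metric[OF p] metric_form_circ_q)
  \<comment> \<open>Writing \<open>x\<close> as its own image under the third power of
    \<open>circ_q\<close> exhibits both arguments as images, so one application can be stripped;
    this leaves the second pair in reverse order.\<close>
  have "sectional W X g nabla p x (circ_q (circ_q x)) =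
      sectional W X g nabla p (circ_q (circ_q (circ_q x))) (circ_q (circ_q x))"
    by (simp only: circ_q_cubed)
  also have "\<dots> = sectional W X g nabla p (circ_q (circ_q x)) (circ_q x)"
    by (rule q)
  also have "\<dots> = sectional W X g nabla p (circ_q x) (circ_q (circ_q x))"
    by (rule sectional_commute[OF p])
  finally show ?thesis using q[of x "circ_q x"] by simp
qed

end
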